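(* Let $0<\nu<1$, $0<\alpha_0<\beta_0$, and let $L_1,N_1:\mathbb R\to\mathbb R$ be such that there are positive constants $L_{1m},L_{1M},N_{1m},N_{1M}$ with $$L_{1m}\le L_1(u_1(\eta))\le L_{1M},\qquad N_{1m}\le N_1(u_1(\eta))\le N_{1M}$$ for all $u_1\in C^0[\alpha_0,\beta_0]$, $\eta\in[\alpha_0,\beta_0]$, and constants $\tilde L_1,\tilde N_1$ with $$\|L_1(f)-L_1(g)\|\le\tilde L_1\|f-g\|,\qquad \|N_1(f)-N_1(g)\|\le\tilde N_1\|f-g\|$$ for all $f,g\in C^0(\mathbb R^+)\cap L^\infty(\mathbb R^+)$, $\mathbb R^+=[0,\infty)$, where $\|\cdot\|$ is the supremum norm and $L_1(f)$, $N_1(f)$ denote composition. If $$\epsilon(\alpha_0,\beta_0)=\frac{2L_{1M}^{\frac{5-\nu}{2}}L_{1m}^{\nu-2}\,\tilde\Phi_1(\alpha_0,\beta_0)}{N_{1m}^{\frac{1-\nu}{2}}\Big[\gamma\big(\tfrac{1-\nu}{2},\beta_0^2\tfrac{N_{1M}}{L_{1m}}\big)-\gamma\big(\tfrac{1-\nu}{2},\alpha_0^2\tfrac{N_{1M}}{L_{1m}}\big)\Big]}<1,$$ where $$\tilde\Phi_1(\alpha_0,\beta_0)=\frac{1}{L_{1m}^{2}}\bigg(\Big(\tilde N_1+\frac{N_{1M}\tilde L_1}{L_{1m}}\Big)\Big[\frac{\beta_0^{3-\nu}}{3-\nu}-\alpha_0^2\frac{\beta_0^{1-\nu}}{1-\nu}+\frac{2\alpha_0^2}{(3-\nu)(1-\nu)}\Big]+\tilde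 L_1\frac{\beta_0^{1-\nu}}{1-\nu}\bigg),$$ then there exists a unique solution $u_1\in C^0[\alpha_0,\beta_0]$ of the integral equation $$u_1(\eta)=1-\frac{\Phi_1[\alpha_0,\eta,u_1]}{\Phi_1[\alpha_0,\beta_0,u_1]},\qquad \alpha_0\le\eta\le\beta_0.$$
   Context: $\gamma(s,x)=\int_0^x t^{s-1}e^{-t}\,dt$ is the lower incomplete gamma function. For $u_1\in C^0[\alpha_0,\beta_0]$ and $\eta\in[\alpha_0,\beta_0]$, $$E_1[\alpha_0,\eta,u_1]=\exp\Big(-2\int_{\alpha_0}^{\eta}s\frac{N_1(u_1(s))}{L_1(u_1(s))}\,ds\Big),\qquad \Phi_1[\alpha_0,\eta,u_1]=\int_{\alpha_0}^{\eta}\frac{E_1[\alpha_0,s,u_1]}{s^{\nu}L_1(u_1(s))}\,ds .$$ *)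

theory Defs
  imports "HOL-Analysis.Analysis"
begin

definition lower_gamma :: "real \<Rightarrow> real \<Rightarrow> real" where
  "lower_gamma s x = integral {0..x} (\<lambda>t. t powr (s - 1) * exp (- t))"

(* Elements are represented by functions on all of real that take the value undefined
   outside S, so that two elements are equal iff they agree on S. *)
definition C0 :: "real set \<Rightarrow> (real \<Rightarrow> real) set" where
  "C0 S = {u \<in> extensional S. continuous_on S u}"

(* Meaningful for nonempty S and f bounded on S, which is the only case in which it is used. *)
definition sup_norm :: "real set \<Rightarrow> (real \<Rightarrow> real) \<Rightarrow> real" where
  "sup_norm S f = (SUP x\<in>S. \<bar>f x\<bar>)"

definition E1 :: "(real \<Rightarrow> real) \<Rightarrow> (real \<Rightarrow> real) \<Rightarrow> real \<Rightarrow> real \<Rightarrow> (real \<Rightarrow> real) \<Rightarrow> real" where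
  "E1 L N \<alpha> \<eta> u = exp (- 2 * integral {\<alpha>..\<eta>} (\<lambda>s. s * (N (u s) / L (u s))))"

definition Phi1 :: "(real \<Rightarrow> real) \<Rightarrow> (real \<Rightarrow> real) \<Rightarrow> real \<Rightarrow> real \<Rightarrow> real \<Rightarrow> (real \<Rightarrow> real) \<Rightarrow> real" where
  "Phi1 L N \<nu> \<alpha> \<eta> u = integral {\<alpha>..\<eta>} (\<lambda>s. E1 L N \<alpha> s u / (s powr \<nu> * L (u s)))"

(* Lm is the lower bound of L, NM the upper bound of N; Lt and Nt are their Lipschitz constants. *)
definition Phi1_tilde ::
  "real \<Rightarrow> real \<Rightarrow> real \<Rightarrow> real \<Rightarrow> real \<Rightarrow> real \<Rightarrow> real \<Rightarrow> real" where
  "Phi1_tilde Lm NM Lt Nt \<nu> \<alpha> \<beta> =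
     1 / Lm ^ 2 *
       ((Nt + NM * Lt / Lm) *
          (\<beta> powr (3 - \<nu>) / (3 - \<nu>) - \<alpha> ^ 2 * (\<beta> powr (1 - \<nu>) / (1 - \<nu>))
             + 2 * \<alpha> ^ 2 / ((3 - \<nu>) * (1 - \<nu>)))
        + Lt * (\<beta> powr (1 - \<nu>) / (1 - \<nu>)))"

definition eps ::
  "real \<Rightarrow> real \<Rightarrow> real \<Rightarrow> real \<Rightarrow> real \<Rightarrow> real \<Rightarrow> real \<Rightarrow> real \<Rightarrow> real \<Rightarrow> real" where
  "eps Lm LM Nm NM Lt Nt \<nu> \<alpha> \<beta> =
     (2 * LM powr ((5 - \<nu>) / 2) * Lm powr (\<nu> - 2) * Phi1_tilde Lm NM Lt Nt \<nu> \<alpha> \<beta>) /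
     (Nm powr ((1 - \<nu>) / 2) *
        (lower_gamma ((1 - \<nu>) / 2) (\<beta> ^ 2 * (NM / Lm))
           - lower_gamma ((1 - \<nu>) / 2) (\<alpha> ^ 2 * (NM / Lm))))"

end

theory Submission
  imports Defs
begin

text \<open>
  The integral equation integrates the boundary value problem
  \<open>(s\<^sup>\<nu> L(u) u')' + 2 s\<^sup>\<nu>\<^sup>+\<^sup>1 N(u) u' = 0\<close>, \<open>u(\<alpha>\<^sub>0) = 1\<close>, \<open>u(\<beta>\<^sub>0) = 0\<close>.

  Existence is by shooting: for fixed \<open>c\<close> the Volterra equation \<open>u(\<eta>) = 1 - c \<Phi>[\<alpha>\<^sub>0,\<eta>,u]\<close> is
  solved by a contraction in an exponentially weighted supremum norm, its end value depends
  continuously on \<open>c\<close>, and the intermediate value theorem gives a \<open>c\<close> with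
  \<open>c \<Phi>[\<alpha>\<^sub>0,\<beta>\<^sub>0,u] = 1\<close>.

  For uniqueness let \<open>u > v\<close> on a maximal interval \<open>(c, d)\<close>, let \<open>P\<close> be the difference of the
  fluxes \<open>s\<^sup>\<nu> L(u) u'\<close> and \<open>s\<^sup>\<nu> L(v) v'\<close>, and let \<open>G' = N\<close>. The equations give
  \<open>(P + 2 s\<^sup>\<nu>\<^sup>+\<^sup>1 (G(u) - G(v)))' = 2 (\<nu> + 1) s\<^sup>\<nu> (G(u) - G(v)) > 0\<close>, hence \<open>P(c) < P(d)\<close>, whereas
  \<open>P(c) \<ge> 0 \<ge> P(d)\<close> because \<open>u - v\<close> vanishes at both ends.
\<close>

section \<open>Zeros and one-sided derivatives of real functions\<close>

text \<open>Take for \<open>c\<close> the last zero before \<open>s\<close> and for \<open>d\<close>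
  the first zero after it. Both exist because the zero sets are compact and contain \<open>a\<close>
  and \<open>b\<close> respectively. A nonpositive value strictly between them would, by the
  intermediate value theorem, produce a zero closer to \<open>s\<close>.\<close>

lemma positive_component:
  fixes f :: "real \<Rightarrow> real"
  assumes cont: "continuous_on {a..b} f" and "f a = 0" "f b = 0" "s \<in> {a..b}" "0 < f s"
  obtains c d where "a \<le> c" "c < d" "d \<le> b" "f c = 0" "f d = 0" "\<And>x. c < x \<Longrightarrow> x < d \<Longrightarrow> 0 < f x"
proof -
  have contL: "continuous_on {a..s} f" and contR: "continuous_on {s..b} f"
    using assms by (auto intro!: continuous_on_subset[OF cont])
  have "compact {x \<in> {a..s}. f x = 0}"
    using continuous_closed_preimage[OF contL, of "{0}"]
    by (auto simp: compact_eq_bounded_closed vimage_def Int_def intro: bounded_subset[OF bounded_closed_interval[of a s]])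
  moreover have "a \<in> {x \<in> {a..s}. f x = 0}" using assms by auto
  ultimately obtain c where c: "c \<in> {a..s}" "f c = 0" "\<And>x. x \<in> {a..s} \<Longrightarrow> f x = 0 \<Longrightarrow> x \<le> c"
    using compact_attains_sup[of "{x \<in> {a..s}. f x = 0}"] by blast
  have "compact {x \<in> {s..b}. f x = 0}"
    using continuous_closed_preimage[OF contR, of "{0}"]
    by (auto simp: compact_eq_bounded_closed vimage_def Int_def intro: bounded_subset[OF bounded_closed_interval[of s b]])
  moreover have "b \<in> {x \<in> {s..b}. f x = 0}" using assms by auto
  ultimately obtain d where d: "d \<in> {s..b}" "f d = 0" "\<And>x. x \<in> {s..b} \<Longrightarrow> f x = 0 \<Longrightarrow> d \<le> x"
    using compact_attains_inf[of "{x \<in> {s..b}. f x = 0}"] by blast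
  have ne: "c \<noteq> s" "d \<noteq> s" using c d \<open>0 < f s\<close> by auto
  have pos: "0 < f x" if "c < x" "x < d" for x
  proof (rule ccontr)
    assume "\<not> 0 < f x"
    show False
    proof (cases "x \<le> s")
      case True
      have "continuous_on {x..s} f" using that c by (auto intro!: continuous_on_subset[OF contL])
      then obtain y where "x \<le> y" "y \<le> s" "f y = 0"
        using IVT'[of f x 0 s] True \<open>\<not> 0 < f x\<close> \<open>0 < f s\<close>
        by auto
      then show False using c(1) c(3)[of y] that by auto
    next
      case False
      have "continuous_on {s..x} f" using that d by (auto intro!: continuous_on_subset[OF contR])
      then obtain y where "s \<le> y" "y \<le> x" "f y = 0"
        using IVT2'[of f x 0 s] False \<open>\<not> 0 < f x\<close> \<open>0 < f s\<close>
        by auto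
      then show False using d(1) d(3)[of y] that by auto
    qed
  qed
  show thesis using c d ne pos by (intro that[of c d]) auto
qed

text \<open>With a negative derivative \<open>f\<close> would drop below \<open>f c\<close>
  immediately to the right of \<open>c\<close>. This lemma and its mirror image at the right end
  give the signs of the flux difference in the uniqueness proof.\<close>

lemma has_real_derivative_nonneg_right:
  fixes f :: "real \<Rightarrow> real"
  assumes der: "(f has_real_derivative D) (at c within S)" and "c < d" "{c..d} \<subseteq> S"
    and ge: "\<And>x. c < x \<Longrightarrow> x < d \<Longrightarrow> f c \<le> f x"
  shows "0 \<le> D"
proof (rule ccontr)
  assume "\<not> 0 \<le> D"
  then obtain e where e: "e > 0" "\<And>h. 0 < h \<Longrightarrow> c + h \<in> S \<Longrightarrow> h < e \<Longrightarrow> f (c + h) < f c"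
    using has_real_derivative_neg_dec_right[OF der] by auto
  \<comment> \<open>Halving the smaller of the two lengths makes both \<open>h < e\<close> and
    \<open>c + h < d\<close> strict.\<close>
  define h where "h = min e (d - c) / 2"
  have "0 < h" "h < e" "c + h < d" using e \<open>c < d\<close> by (auto simp: h_def min_def field_simps)
  moreover from this have "c + h \<in> S" using assms(3) by auto
  ultimately show False using e(2)[of h] ge[of "c + h"] by auto
qed

lemma has_real_derivative_nonpos_left:
  fixes f :: "real \<Rightarrow> real"
  assumes der: "(f has_real_derivative D) (at d within S)" and "c < d" "{c..d} \<subseteq> S"
    and ge: "\<And>x. c < x \<Longrightarrow> x < d \<Longrightarrow> f d \<le> f x"
  shows "D \<le> 0"
proof (rule ccontr)
  assume "\<not> D \<le> 0"
  then obtain e where e: "e > 0" "\<And>h. 0 < h \<Longrightarrow> d - h \<in> S \<Longrightarrow> h < e \<Longrightarrow> f (d - h) < f d"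
    using has_real_derivative_pos_inc_left[OF der] by auto
  define h where "h = min e (d - c) / 2"
  have "0 < h" "h < e" "c < d - h" using e \<open>c < d\<close> by (auto simp: h_def min_def field_simps)
  moreover from this have "d - h \<in> S" using assms(3) by auto
  ultimately show False using e(2)[of h] ge[of "d - h"] by auto
qed

section \<open>Contractions in an exponentially weighted supremum norm\<close>

text \<open>Integrating \<open>exp (k * s)\<close> gains a factor \<open>1 / k\<close>; the
  contribution of the lower limit is negative and is dropped. This gain makes a Volterra operator a
  contraction once \<open>k\<close> is large.\<close>

lemma integral_diff_exp_bound:
  fixes f g :: "real \<Rightarrow> real"
  assumes "continuous_on {a..t} f" "continuous_on {a..t} g" "a \<le> t" "0 < k" "0 \<le> C"
    and le: "\<And>s. s \<in> {a..t} \<Longrightarrow> \<bar>f s - g s\<bar> \<le> C * exp (k * s)"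
  shows "\<bar>integral {a..t} f - integral {a..t} g\<bar> \<le> C / k * exp (k * t)"
proof -
  have prim: "((\<lambda>s. C * exp (k * s)) has_integral (C / k * exp (k * t) - C / k * exp (k * a))) {a..t}"
    using \<open>a \<le> t\<close> \<open>0 < k\<close>
    by (intro fundamental_theorem_of_calculus)
      (auto simp: has_real_derivative_iff_has_vector_derivative[symmetric] intro!: derivative_eq_intros)
  have int: "f integrable_on {a..t}" "g integrable_on {a..t}"
    using assms by (auto intro: integrable_continuous_real)
  have "\<bar>integral {a..t} f - integral {a..t} g\<bar> = norm (integral {a..t} (\<lambda>s. f s - g s))"
    using int by (simp add: integral_diff)
  also have "\<dots> \<le> integral {a..t} (\<lambda>s. C * exp (k * s))"
    using int prim le by (intro integral_norm_bound_integral integrable_diff) auto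
  also have "\<dots> = C / k * exp (k * t) - C / k * exp (k * a)"
    using prim by (rule integral_unique)
  also have "\<dots> \<le> C / k * exp (k * t)" using assms by simp
  finally show ?thesis .
qed

text \<open>Dividing by the weight \<open>exp (k * s)\<close> turns the weighted norm into the plain
  supremum norm, so Banach's theorem applies in the complete space of bounded continuous functions
  on the line. Here \<open>D\<close> ranges over all bounds of the weighted distance, so the norm
  itself need not be named.\<close>

lemma weighted_contraction_fixed_point:
  fixes T :: "(real \<Rightarrow> real) \<Rightarrow> real \<Rightarrow> real"
  assumes "a \<le> b" "0 \<le> q" "q < 1"
    and cont: "\<And>u. continuous_on {a..b} u \<Longrightarrow> continuous_on {a..b} (T u)"
    and contr: "\<And>u v D s. \<lbrakk>continuous_on {a..b} u; continuous_on {a..b} v; 0 \<le> D;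
        \<And>s. s \<in> {a..b} \<Longrightarrow> \<bar>u s - v s\<bar> \<le> D * exp (k * s); s \<in> {a..b}\<rbrakk>
        \<Longrightarrow> \<bar>T u s - T v s\<bar> \<le> q * D * exp (k * s)"
  obtains u where "continuous_on {a..b} u" "\<And>s. s \<in> {a..b} \<Longrightarrow> T u s = u s"
proof -
  \<comment> \<open>Clamping to \<open>{a..b}\<close> extends a function constantly beyond both
    ends, which keeps it continuous and bounded on the whole line.\<close>
  define cl where "cl x = max a (min b x)" for x
  have cl: "cl x \<in> {a..b}" "x \<in> {a..b} \<Longrightarrow> cl x = x" for x
    using \<open>a \<le> b\<close> by (auto simp: cl_def)
  \<comment> \<open>\<open>up\<close> multiplies by the weight, and \<open>S0\<close> is
    \<open>T\<close> conjugated by it and extended by clamping.\<close>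
  define up where "up \<phi> s = exp (k * s) * apply_bcontfun \<phi> s" for \<phi> :: "real \<Rightarrow>\<^sub>C real" and s
  define S0 where "S0 \<phi> x = exp (- (k * cl x)) * T (up \<phi>) (cl x)" for \<phi> x
  have up: "continuous_on {a..b} (up \<phi>)" for \<phi>
    unfolding up_def by (intro continuous_intros continuous_on_apply_bcontfun)
  have S0: "S0 \<phi> \<in> bcontfun" for \<phi>
  proof -
    let ?h = "\<lambda>x. exp (- (k * x)) * T (up \<phi>) x"
    have h: "continuous_on {a..b} ?h" by (intro continuous_intros cont up)
    have "continuous_on UNIV (?h \<circ> cl)"
    proof (rule continuous_on_compose)
      show "continuous_on UNIV cl" unfolding cl_def by (intro continuous_intros)
      show "continuous_on (cl ` UNIV) ?h" using cl(1) by (auto intro: continuous_on_subset[OF h])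
    qed
    moreover have "bounded (range (?h \<circ> cl))"
      using cl(1) by (intro bounded_subset[OF compact_imp_bounded[OF compact_continuous_image[OF h]]]) auto
    moreover have "S0 \<phi> = ?h \<circ> cl" by (auto simp: S0_def)
    ultimately show ?thesis by (simp add: bcontfun_def)
  qed
  have "dist (Bcontfun (S0 \<phi>)) (Bcontfun (S0 \<psi>)) \<le> q * dist \<phi> \<psi>" for \<phi> \<psi>
  proof (rule dist_bound)
    fix x
    have "\<bar>up \<phi> s - up \<psi> s\<bar> \<le> dist \<phi> \<psi> * exp (k * s)" for s
    proof -
      have "\<bar>up \<phi> s - up \<psi> s\<bar> = exp (k * s) * \<bar>apply_bcontfun \<phi> s - apply_bcontfun \<psi> s\<bar>"
        by (simp add: up_def abs_mult flip: right_diff_distrib)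
      then show ?thesis using dist_bounded[of \<phi> s \<psi>] by (simp add: dist_real_def mult.commute)
    qed
    then have "\<bar>T (up \<phi>) (cl x) - T (up \<psi>) (cl x)\<bar> \<le> q * dist \<phi> \<psi> * exp (k * cl x)"
      by (intro contr up cl) auto
    then have "exp (- (k * cl x)) * \<bar>T (up \<phi>) (cl x) - T (up \<psi>) (cl x)\<bar>
        \<le> exp (- (k * cl x)) * (q * dist \<phi> \<psi> * exp (k * cl x))"
      by (intro mult_left_mono) auto
    also have "\<dots> = q * dist \<phi> \<psi>" by (simp add: exp_minus)
    finally show "dist (apply_bcontfun (Bcontfun (S0 \<phi>)) x) (apply_bcontfun (Bcontfun (S0 \<psi>)) x) \<le> q * dist \<phi> \<psi>"
      by (simp add: Bcontfun_inverse S0 dist_real_def S0_def abs_mult flip: right_diff_distrib)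
  qed
  then obtain \<phi> where "Bcontfun (S0 \<phi>) = \<phi>"
    using banach_fix_type[of q "\<lambda>\<phi>. Bcontfun (S0 \<phi>)"] assms by blast
  then have \<phi>: "apply_bcontfun \<phi> = S0 \<phi>" using Bcontfun_inverse[OF S0] by metis
  show thesis
  proof (rule that[of "up \<phi>"])
    fix s assume "s \<in> {a..b}"
    then have "apply_bcontfun \<phi> s = exp (- (k * s)) * T (up \<phi>) s"
      using \<phi> cl(2) by (simp add: S0_def)
    then show "T (up \<phi>) s = up \<phi> s" by (simp add: up_def exp_minus)
  qed (rule up)
qed

section \<open>Pointwise form of the hypotheses\<close>

text \<open>The conditions on composed functions reduce to these conditions on real arguments by
  inserting constant functions.\<close>

locale similarity_bvp =
  fixes L N :: "real \<Rightarrow> real" and \<nu> a b Lm LM NM Lt Nt :: real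
  assumes \<nu>_pos: "0 < \<nu>" and a_pos: "0 < a" and a_less_b: "a < b" and Lm_pos: "0 < Lm"
    and L_ge: "\<And>x. Lm \<le> L x" and L_le: "\<And>x. L x \<le> LM"
    and N_pos: "\<And>x. 0 < N x" and N_le: "\<And>x. N x \<le> NM"
    and L_lip: "\<And>x y. \<bar>L x - L y\<bar> \<le> Lt * \<bar>x - y\<bar>"
    and N_lip: "\<And>x y. \<bar>N x - N y\<bar> \<le> Nt * \<bar>x - y\<bar>"
begin

text \<open>The integrand of \<open>Phi1\<close>: a solution of
  \<open>u s = 1 - c * Phi1 L N \<nu> a s u\<close> has derivative
  \<open>- c * w u s\<close>.\<close>

definition w :: "(real \<Rightarrow> real) \<Rightarrow> real \<Rightarrow> real" where
  "w u s = E1 L N a s u / (s powr \<nu> * L (u s))"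

lemma Phi1_eq: "Phi1 L N \<nu> a s u = integral {a..s} (w u)"
  by (simp add: Phi1_def w_def[abs_def])

lemma L_pos: "0 < L x" using L_ge[of x] Lm_pos by linarith
lemma LM_pos: "0 < LM" using L_pos[of 0] L_le[of 0] by linarith
lemma NM_pos: "0 < NM" using N_pos[of 0] N_le[of 0] by linarith
lemma Lt_nonneg: "0 \<le> Lt" using L_lip[of 1 0] by simp
lemma Nt_nonneg: "0 \<le> Nt" using N_lip[of 1 0] by simp

lemma cont_L: "continuous_on A L"
  using L_lip Lt_nonneg by (intro lipschitz_on_continuous_on[of Lt] lipschitz_onI) (auto simp: dist_real_def)

lemma cont_N: "continuous_on A N"
  using N_lip Nt_nonneg by (intro lipschitz_on_continuous_on[of Nt] lipschitz_onI) (auto simp: dist_real_def)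

lemma inverse_L_lip: "\<bar>1 / L x - 1 / L y\<bar> \<le> Lt / Lm\<^sup>2 * \<bar>x - y\<bar>"
proof -
  have "1 / L x - 1 / L y = (L y - L x) / (L x * L y)"
    using L_pos[of x] L_pos[of y] by (simp add: diff_divide_distrib)
  then have "\<bar>1 / L x - 1 / L y\<bar> = \<bar>L x - L y\<bar> / (L x * L y)"
    using L_pos[of x] L_pos[of y] by (simp add: abs_mult abs_minus_commute)
  also have "\<dots> \<le> (Lt * \<bar>x - y\<bar>) / (Lm * Lm)"
    using L_lip[of x y] L_ge[of x] L_ge[of y] Lm_pos by (intro frac_le mult_mono) auto
  finally show ?thesis by (simp add: power2_eq_square)
qed

lemma N_over_L_lip: "\<bar>N x / L x - N y / L y\<bar> \<le> (Nt / Lm + NM * Lt / Lm\<^sup>2) * \<bar>x - y\<bar>"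
proof -
  \<comment> \<open>Add and subtract \<open>N y / L x\<close>, so that only one of the two functions
    varies in each term.\<close>
  have "\<bar>N x / L x - N y / L y\<bar> = \<bar>(N x - N y) / L x + N y * (1 / L x - 1 / L y)\<bar>"
    by (simp add: diff_divide_distrib right_diff_distrib)
  also have "\<dots> \<le> \<bar>N x - N y\<bar> / L x + N y * \<bar>1 / L x - 1 / L y\<bar>"
    using abs_triangle_ineq[of "(N x - N y) / L x" "N y * (1 / L x - 1 / L y)"] L_pos[of x] N_pos[of y]
    by (simp add: abs_mult)
  also have "\<dots> \<le> (Nt * \<bar>x - y\<bar>) / Lm + NM * (Lt / Lm\<^sup>2 * \<bar>x - y\<bar>)"
    using N_lip[of x y] inverse_L_lip[of x y] L_ge[of x] N_le[of y] N_pos[of y] Lm_pos NM_pos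
    by (intro add_mono frac_le mult_mono) auto
  finally show ?thesis by (simp add: field_simps)
qed

lemma N_over_L_nonneg: "0 \<le> N x / L x"
  using N_pos[of x] L_pos[of x] by simp

lemma N_over_L_le: "N x / L x \<le> NM / Lm"
  using N_le[of x] L_ge[of x] N_pos[of x] Lm_pos by (intro frac_le) auto

section \<open>Bounds and derivatives along a fixed continuous function\<close>

context
  fixes u :: "real \<Rightarrow> real"
  assumes u: "continuous_on {a..b} u"
begin

lemma cont_L_comp: "continuous_on {a..b} (\<lambda>s. L (u s))"
  using continuous_on_compose[OF u cont_L] by (simp add: o_def)

lemma cont_N_comp: "continuous_on {a..b} (\<lambda>s. N (u s))"
  using continuous_on_compose[OF u cont_N] by (simp add: o_def)

lemma cont_rate: "continuous_on {a..b} (\<lambda>s. s * (N (u s) / L (u s)))"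
  using L_pos by (intro continuous_intros cont_L_comp cont_N_comp) (auto simp: less_le)

lemma E1_deriv:
  assumes "s \<in> {a..b}"
  shows "((\<lambda>s. E1 L N a s u) has_real_derivative (- 2 * (s * (N (u s) / L (u s))) * E1 L N a s u))
    (at s within {a..b})"
  unfolding E1_def
  by (rule derivative_eq_intros refl integral_has_real_derivative[OF cont_rate assms])+ simp

lemma cont_E1: "continuous_on {a..b} (\<lambda>s. E1 L N a s u)"
  using E1_deriv by (meson DERIV_continuous continuous_on_eq_continuous_within)

lemma cont_w: "continuous_on {a..b} (w u)"
  unfolding w_def[abs_def] using L_pos a_pos
  by (intro continuous_intros cont_L_comp cont_E1) (auto simp: less_le)

lemma rate_integral_nonneg:
  assumes "s \<in> {a..b}"
  shows "0 \<le> integral {a..s} (\<lambda>s. s * (N (u s) / L (u s)))"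
  using a_pos assms N_over_L_nonneg
  by (intro integral_nonneg integrable_continuous_real continuous_on_subset[OF cont_rate] mult_nonneg_nonneg) auto

lemma E1_le_1:
  assumes "s \<in> {a..b}"
  shows "E1 L N a s u \<le> 1"
  using rate_integral_nonneg[OF assms] by (simp add: E1_def)

lemma E1_ge:
  assumes s: "s \<in> {a..b}"
  shows "exp (- 2 * (b * (NM / Lm) * (b - a))) \<le> E1 L N a s u"
proof -
  have "norm (integral {a..s} (\<lambda>s. s * (N (u s) / L (u s)))) \<le> (b * (NM / Lm)) * (s - a)"
  proof (intro integral_bound continuous_on_subset[OF cont_rate])
    fix t assume t: "t \<in> {a..s}"
    then have "t * (N (u t) / L (u t)) \<le> b * (NM / Lm)"
      using s a_pos by (intro mult_mono N_over_L_le N_over_L_nonneg) auto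
    moreover have "0 \<le> t * (N (u t) / L (u t))"
      using t a_pos by (intro mult_nonneg_nonneg N_over_L_nonneg) auto
    ultimately show "norm (t * (N (u t) / L (u t))) \<le> b * (NM / Lm)" by simp
  qed (use s in auto)
  also have "\<dots> \<le> (b * (NM / Lm)) * (b - a)"
    using s a_pos NM_pos Lm_pos by (intro mult_left_mono) auto
  finally show ?thesis by (simp add: E1_def)
qed

lemma w_ge:
  assumes s: "s \<in> {a..b}"
  shows "exp (- 2 * (b * (NM / Lm) * (b - a))) / (b powr \<nu> * LM) \<le> w u s"
  unfolding w_def using s a_pos E1_ge[OF s] L_pos \<nu>_pos L_le
  by (intro frac_le mult_mono powr_mono2) (auto intro: mult_pos_pos less_imp_le order.trans[OF less_imp_le[OF exp_gt_zero]])

lemma w_le: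
  assumes s: "s \<in> {a..b}"
  shows "w u s \<le> 1 / (a powr \<nu> * Lm)"
  unfolding w_def using s a_pos E1_le_1[OF s] Lm_pos \<nu>_pos L_ge
  by (intro frac_le mult_mono powr_mono2) auto

lemma w_pos: "s \<in> {a..b} \<Longrightarrow> 0 < w u s"
  using a_pos L_pos by (auto simp: w_def E1_def)

lemma Phi1_deriv:
  assumes "s \<in> {a..b}"
  shows "((\<lambda>s. Phi1 L N \<nu> a s u) has_real_derivative w u s) (at s within {a..b})"
  unfolding Phi1_eq by (rule integral_has_real_derivative[OF cont_w assms])

lemma cont_Phi1: "continuous_on {a..b} (\<lambda>s. Phi1 L N \<nu> a s u)"
  using Phi1_deriv by (meson DERIV_continuous continuous_on_eq_continuous_within)

lemma abs_Phi1_le: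
  assumes s: "s \<in> {a..b}"
  shows "\<bar>Phi1 L N \<nu> a s u\<bar> \<le> 1 / (a powr \<nu> * Lm) * (b - a)"
proof -
  have "norm (Phi1 L N \<nu> a s u) \<le> 1 / (a powr \<nu> * Lm) * (s - a)"
    unfolding Phi1_eq using s w_le w_pos
    by (intro integral_bound continuous_on_subset[OF cont_w]) (auto simp: less_imp_le)
  also have "\<dots> \<le> 1 / (a powr \<nu> * Lm) * (b - a)"
    using s Lm_pos by (intro mult_left_mono) auto
  finally show ?thesis by simp
qed

text \<open>Integrating the lower bound of \<open>w\<close> gives a bound that does not depend on
  \<open>u\<close>. It determines how large the shooting parameter has to become.\<close>

lemma Phi1_end_ge:
  "exp (- 2 * (b * (NM / Lm) * (b - a))) / (b powr \<nu> * LM) * (b - a) \<le> Phi1 L N \<nu> a b u"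
proof -
  let ?m = "exp (- 2 * (b * (NM / Lm) * (b - a))) / (b powr \<nu> * LM)"
  have "integral {a..b} (\<lambda>_. ?m) \<le> integral {a..b} (w u)"
    by (intro integral_le integrable_continuous_real cont_w w_ge) auto
  then show ?thesis using a_less_b by (simp add: Phi1_eq mult.commute)
qed

lemma Phi1_end_pos: "0 < Phi1 L N \<nu> a b u"
proof -
  have "0 < exp (- 2 * (b * (NM / Lm) * (b - a))) / (b powr \<nu> * LM) * (b - a)"
    using a_pos a_less_b LM_pos by simp
  then show ?thesis using Phi1_end_ge by linarith
qed

end

section \<open>Weighted Lipschitz estimates for \<open>E1\<close>, \<open>w\<close> and
  \<open>Phi1\<close>\<close>

lemma E1_lip:
  assumes u: "continuous_on {a..b} u" and v: "continuous_on {a..b} v" and "0 \<le> D" and "1 \<le> k"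
    and le: "\<And>s. s \<in> {a..b} \<Longrightarrow> \<bar>u s - v s\<bar> \<le> D * exp (k * s)" and s: "s \<in> {a..b}"
  shows "\<bar>E1 L N a s u - E1 L N a s v\<bar> \<le> 2 * b * (Nt / Lm + NM * Lt / Lm\<^sup>2) * D * exp (k * s)"
proof -
  let ?C = "Nt / Lm + NM * Lt / Lm\<^sup>2"
  let ?I = "\<lambda>u. integral {a..s} (\<lambda>s. s * (N (u s) / L (u s)))"
  have C: "0 \<le> ?C" using Nt_nonneg Lt_nonneg NM_pos Lm_pos by simp
  have rate: "continuous_on {a..s} (\<lambda>s. s * (N (u s) / L (u s)))" if "continuous_on {a..b} u" for u
    using s by (intro continuous_on_subset[OF cont_rate[OF that]]) auto
  have "\<bar>?I u - ?I v\<bar> \<le> (b * ?C * D) / k * exp (k * s)"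
  proof (rule integral_diff_exp_bound)
    fix t assume t: "t \<in> {a..s}"
    have "\<bar>t * (N (u t) / L (u t)) - t * (N (v t) / L (v t))\<bar> = t * \<bar>N (u t) / L (u t) - N (v t) / L (v t)\<bar>"
      using t a_pos by (simp add: abs_mult flip: right_diff_distrib del: times_divide_eq_right)
    also have "\<dots> \<le> b * (?C * (D * exp (k * t)))"
      using t s a_pos le[of t] C
      by (intro mult_mono order.trans[OF N_over_L_lip] mult_left_mono) auto
    finally show "\<bar>t * (N (u t) / L (u t)) - t * (N (v t) / L (v t))\<bar> \<le> b * ?C * D * exp (k * t)"
      by (simp add: mult.assoc)
  qed (use s a_pos C \<open>0 \<le> D\<close> \<open>1 \<le> k\<close> rate[OF u] rate[OF v] in auto)
  \<comment> \<open>The gain \<open>1 / k\<close> is given up here, so that the constant does not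
    depend on \<open>k\<close>.\<close>
  also have "\<dots> \<le> (b * ?C * D) / 1 * exp (k * s)"
    using C a_pos a_less_b \<open>0 \<le> D\<close> \<open>1 \<le> k\<close> by (intro mult_right_mono divide_left_mono) auto
  finally have I: "\<bar>?I u - ?I v\<bar> \<le> b * ?C * D * exp (k * s)" by simp
  \<comment> \<open>The map \<open>exp (- x)\<close> is 1-Lipschitz for nonnegative
    \<open>x\<close>: factor out the larger exponential, which is at most 1, and use
    \<open>1 + z \<le> exp z\<close>.\<close>
  have "\<bar>exp (- x) - exp (- y)\<bar> \<le> \<bar>x - y\<bar>" if "0 \<le> x" "0 \<le> y" for x y :: real
  proof -
    have *: "exp (- x) - exp (- y) \<le> y - x" if "0 \<le> x" "x \<le> y" for x y :: real
    proof -
      have "1 - exp (x - y) \<le> y - x" using exp_ge_add_one_self[of "x - y"] by linarith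
      have "exp (- x) - exp (- y) = exp (- x) * (1 - exp (x - y))"
        by (simp add: algebra_simps flip: exp_add)
      also have "\<dots> \<le> 1 * (y - x)"
        using that \<open>1 - exp (x - y) \<le> y - x\<close> by (intro mult_mono) auto
      finally show ?thesis by simp
    qed
    show ?thesis using *[of x y] *[of y x] that by (cases "x \<le> y") (auto simp: abs_if)
  qed
  from this[of "2 * ?I u" "2 * ?I v"] rate_integral_nonneg[OF u s] rate_integral_nonneg[OF v s]
  have "\<bar>E1 L N a s u - E1 L N a s v\<bar> \<le> \<bar>2 * ?I u - 2 * ?I v\<bar>" by (simp add: E1_def)
  then show ?thesis using I by simp
qed

text \<open>One constant \<open>A\<close> serves all weights \<open>k \<ge> 1\<close>, so
  \<open>k\<close> may afterwards be chosen in terms of \<open>A\<close>. The difference splits into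
  a change of \<open>E1\<close> and a change of \<open>1 / L\<close>.\<close>

lemma w_lip:
  obtains A where "0 \<le> A"
    "\<And>u v D k s. \<lbrakk>continuous_on {a..b} u; continuous_on {a..b} v; 0 \<le> D; 1 \<le> k;
      \<And>s. s \<in> {a..b} \<Longrightarrow> \<bar>u s - v s\<bar> \<le> D * exp (k * s); s \<in> {a..b}\<rbrakk>
      \<Longrightarrow> \<bar>w u s - w v s\<bar> \<le> A * D * exp (k * s)"
proof -
  define C where "C = 2 * b * (Nt / Lm + NM * Lt / Lm\<^sup>2)"
  define G where "G = Lt / Lm\<^sup>2"
  define A where "A = 1 / a powr \<nu> * (C * (1 / Lm) + 1 * G)"
  have C: "0 \<le> C" and G: "0 \<le> G"
    using Nt_nonneg Lt_nonneg NM_pos Lm_pos a_pos a_less_b by (auto simp: C_def G_def)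
  show thesis
  proof (rule that[of A])
    show "0 \<le> A" using C G Lm_pos unfolding A_def
      by (intro mult_nonneg_nonneg add_nonneg_nonneg) auto
    fix u v :: "real \<Rightarrow> real" and D k s :: real
    assume u: "continuous_on {a..b} u" and v: "continuous_on {a..b} v" and D: "0 \<le> D" and k: "1 \<le> k"
      and le: "\<And>s. s \<in> {a..b} \<Longrightarrow> \<bar>u s - v s\<bar> \<le> D * exp (k * s)" and s: "s \<in> {a..b}"
    let ?e = "D * exp (k * s)"
    have e: "0 \<le> ?e" using D by simp
    have E: "\<bar>E1 L N a s u - E1 L N a s v\<bar> \<le> C * ?e"
      using E1_lip[OF u v D k le s] by (simp add: mult.assoc C_def)
    have I: "\<bar>1 / L (u s) - 1 / L (v s)\<bar> \<le> G * ?e"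
      using order.trans[OF inverse_L_lip mult_left_mono[OF le[OF s] G[unfolded G_def]]] unfolding G_def .
    have E0: "0 \<le> E1 L N a s v" by (simp add: E1_def)
    have "w u s - w v s = 1 / s powr \<nu> * ((E1 L N a s u - E1 L N a s v) * (1 / L (u s))
        + E1 L N a s v * (1 / L (u s) - 1 / L (v s)))"
      by (simp add: w_def diff_divide_distrib right_diff_distrib distrib_left mult.commute)
    then have "\<bar>w u s - w v s\<bar> = 1 / s powr \<nu> * \<bar>(E1 L N a s u - E1 L N a s v) * (1 / L (u s))
        + E1 L N a s v * (1 / L (u s) - 1 / L (v s))\<bar>"
      by (simp only: abs_mult) simp
    also have "\<dots> \<le> 1 / s powr \<nu> * (\<bar>E1 L N a s u - E1 L N a s v\<bar> * (1 / L (u s))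
        + E1 L N a s v * \<bar>1 / L (u s) - 1 / L (v s)\<bar>)"
      using abs_triangle_ineq[of "(E1 L N a s u - E1 L N a s v) * (1 / L (u s))" "E1 L N a s v * (1 / L (u s) - 1 / L (v s))"]
        L_pos[of "u s"] E0
      by (intro mult_left_mono) (simp_all add: abs_mult)
    also have "\<dots> \<le> 1 / a powr \<nu> * ((C * ?e) * (1 / Lm) + 1 * (G * ?e))"
      using E I E0 E1_le_1[OF v s] L_pos[of "u s"] L_ge[of "u s"] Lm_pos a_pos s \<nu>_pos C G e D
      by (intro mult_mono add_mono frac_le powr_mono2 add_nonneg_nonneg mult_nonneg_nonneg) auto
    also have "\<dots> = A * ?e" by (simp add: A_def algebra_simps add_divide_distrib)
    finally show "\<bar>w u s - w v s\<bar> \<le> A * D * exp (k * s)" by (simp add: mult.assoc)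
  qed
qed

lemma Phi1_weighted_lip:
  assumes "0 < M"
  obtains k where "1 \<le> k"
    "\<And>u v D s. \<lbrakk>continuous_on {a..b} u; continuous_on {a..b} v; 0 \<le> D;
      \<And>s. s \<in> {a..b} \<Longrightarrow> \<bar>u s - v s\<bar> \<le> D * exp (k * s); s \<in> {a..b}\<rbrakk>
      \<Longrightarrow> M * \<bar>Phi1 L N \<nu> a s u - Phi1 L N \<nu> a s v\<bar> \<le> 1 / 2 * D * exp (k * s)"
proof -
  obtain A where A: "0 \<le> A"
    "\<And>u v D k s. \<lbrakk>continuous_on {a..b} u; continuous_on {a..b} v; 0 \<le> D; 1 \<le> k;
      \<And>s. s \<in> {a..b} \<Longrightarrow> \<bar>u s - v s\<bar> \<le> D * exp (k * s); s \<in> {a..b}\<rbrakk>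
      \<Longrightarrow> \<bar>w u s - w v s\<bar> \<le> A * D * exp (k * s)"
    using w_lip by blast
  \<comment> \<open>This makes \<open>M * A / k \<le> 1 / 2\<close>; the summand 1 ensures
    \<open>1 \<le> k\<close> even if \<open>A = 0\<close>.\<close>
  define k where "k = 2 * M * A + 1"
  have k: "1 \<le> k" using A assms by (simp add: k_def)
  show thesis
  proof (rule that[OF k])
    fix u v :: "real \<Rightarrow> real" and D s :: real
    assume u: "continuous_on {a..b} u" and v: "continuous_on {a..b} v" and D: "0 \<le> D"
      and le: "\<And>s. s \<in> {a..b} \<Longrightarrow> \<bar>u s - v s\<bar> \<le> D * exp (k * s)" and s: "s \<in> {a..b}"
    have "\<bar>Phi1 L N \<nu> a s u - Phi1 L N \<nu> a s v\<bar> \<le> A * D / k * exp (k * s)"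
      unfolding Phi1_eq
    proof (rule integral_diff_exp_bound)
      fix t assume "t \<in> {a..s}"
      then show "\<bar>w u t - w v t\<bar> \<le> A * D * exp (k * t)"
        using s by (intro A(2)[OF u v D k le]) auto
    qed (use s k A D u v in \<open>auto intro: continuous_on_subset[OF cont_w]\<close>)
    then have "M * \<bar>Phi1 L N \<nu> a s u - Phi1 L N \<nu> a s v\<bar> \<le> M * (A * D / k * exp (k * s))"
      using assms by (intro mult_left_mono) auto
    also have "\<dots> = (M * A / k) * (D * exp (k * s))" by simp
    also have "\<dots> \<le> 1 / 2 * (D * exp (k * s))"
      using k D by (intro mult_right_mono) (auto simp: k_def field_simps)
    finally show "M * \<bar>Phi1 L N \<nu> a s u - Phi1 L N \<nu> a s v\<bar> \<le> 1 / 2 * D * exp (k * s)" by simp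
  qed
qed

section \<open>Existence by shooting\<close>

theorem existence:
  obtains u where "continuous_on {a..b} u"
    "\<And>s. s \<in> {a..b} \<Longrightarrow> u s = 1 - Phi1 L N \<nu> a s u / Phi1 L N \<nu> a b u"
proof -
  \<comment> \<open>The lower bound of \<open>Phi1\<close> at \<open>b\<close>, uniform in
    \<open>u\<close>. For \<open>c = M = 1 / m\<close> the product \<open>c * Phi1\<close> is at
    least 1 at \<open>b\<close>, so the end value is at most 0 there.\<close>
  define m where "m = exp (- 2 * (b * (NM / Lm) * (b - a))) / (b powr \<nu> * LM) * (b - a)"
  have "0 < m" unfolding m_def using a_pos a_less_b LM_pos by simp
  define M where "M = 1 / m"
  have "0 < M" using \<open>0 < m\<close> by (simp add: M_def)
  obtain k where k: "1 \<le> k"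
    "\<And>u v D s. \<lbrakk>continuous_on {a..b} u; continuous_on {a..b} v; 0 \<le> D;
      \<And>s. s \<in> {a..b} \<Longrightarrow> \<bar>u s - v s\<bar> \<le> D * exp (k * s); s \<in> {a..b}\<rbrakk>
      \<Longrightarrow> M * \<bar>Phi1 L N \<nu> a s u - Phi1 L N \<nu> a s v\<bar> \<le> 1 / 2 * D * exp (k * s)"
    using Phi1_weighted_lip[OF \<open>0 < M\<close>] by blast
  \<comment> \<open>Since \<open>c \<le> M\<close>, a single weight \<open>k\<close> gives the
    contraction factor 1/2 for every admissible \<open>c\<close>.\<close>
  have contr: "\<bar>(1 - c * Phi1 L N \<nu> a s u) - (1 - c * Phi1 L N \<nu> a s v)\<bar> \<le> 1 / 2 * D * exp (k * s)"
    if "c \<in> {0..M}" "continuous_on {a..b} u" "continuous_on {a..b} v" "0 \<le> D"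
      "\<And>s. s \<in> {a..b} \<Longrightarrow> \<bar>u s - v s\<bar> \<le> D * exp (k * s)" "s \<in> {a..b}" for c u v D s
  proof -
    have "\<bar>(1 - c * Phi1 L N \<nu> a s u) - (1 - c * Phi1 L N \<nu> a s v)\<bar>
        = c * \<bar>Phi1 L N \<nu> a s u - Phi1 L N \<nu> a s v\<bar>"
      using that(1) by (simp add: abs_mult abs_minus_commute flip: right_diff_distrib)
    also have "\<dots> \<le> M * \<bar>Phi1 L N \<nu> a s u - Phi1 L N \<nu> a s v\<bar>"
      using that(1) by (intro mult_right_mono) auto
    also have "\<dots> \<le> 1 / 2 * D * exp (k * s)" using that by (intro k(2)) auto
    finally show ?thesis .
  qed
  have "\<exists>u. continuous_on {a..b} u \<and> (\<forall>s\<in>{a..b}. 1 - c * Phi1 L N \<nu> a s u = u s)" if "c \<in> {0..M}" for c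
    by (rule weighted_contraction_fixed_point[of a b "1/2" "\<lambda>u s. 1 - c * Phi1 L N \<nu> a s u" k])
      (use that a_less_b contr in \<open>auto intro!: continuous_intros cont_Phi1\<close>)
  then obtain U where U: "\<And>c. c \<in> {0..M} \<Longrightarrow> continuous_on {a..b} (U c)"
    "\<And>c s. c \<in> {0..M} \<Longrightarrow> s \<in> {a..b} \<Longrightarrow> U c s = 1 - c * Phi1 L N \<nu> a s (U c)"
    by metis
  define B where "B = 1 / (a powr \<nu> * Lm) * (b - a)"
  have "0 \<le> B" using Lm_pos a_less_b by (simp add: B_def)
  have U_lip: "\<bar>U c b - U d b\<bar> \<le> 2 * B * exp (k * b) * \<bar>c - d\<bar>" if cd: "c \<in> {0..M}" "d \<in> {0..M}" for c d
  proof -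
    \<comment> \<open>Compare the two solutions at the point \<open>t\<close> where their weighted
      distance is largest; that maximum then serves as the constant \<open>D\<close> of the
      contraction estimate.\<close>
    let ?f = "\<lambda>s. exp (- (k * s)) * \<bar>U c s - U d s\<bar>"
    have "continuous_on {a..b} ?f" using cd by (intro continuous_intros U)
    then obtain t where t: "t \<in> {a..b}" "\<And>s. s \<in> {a..b} \<Longrightarrow> ?f s \<le> ?f t"
      using continuous_attains_sup[of "{a..b}" ?f] a_less_b by auto
    have le: "\<bar>U c s - U d s\<bar> \<le> ?f t * exp (k * s)" if "s \<in> {a..b}" for s
      using mult_right_mono[OF t(2)[OF that], of "exp (k * s)"] by (simp add: exp_minus field_simps)
    \<comment> \<open>Separate the change of the function at fixed \<open>c\<close> from the change
      of the parameter. The first part is at most half of the left-hand side and is absorbed into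
      it.\<close>
    have "\<bar>U c t - U d t\<bar> = \<bar>((1 - c * Phi1 L N \<nu> a t (U c)) - (1 - c * Phi1 L N \<nu> a t (U d)))
        + (d - c) * Phi1 L N \<nu> a t (U d)\<bar>"
      using U(2)[OF cd(1) t(1)] U(2)[OF cd(2) t(1)] by (simp add: algebra_simps)
    also have "\<dots> \<le> \<bar>(1 - c * Phi1 L N \<nu> a t (U c)) - (1 - c * Phi1 L N \<nu> a t (U d))\<bar>
        + \<bar>d - c\<bar> * \<bar>Phi1 L N \<nu> a t (U d)\<bar>"
      unfolding abs_mult[symmetric] by (rule abs_triangle_ineq)
    also have "\<dots> \<le> 1 / 2 * ?f t * exp (k * t) + \<bar>d - c\<bar> * B"
      unfolding B_def using cd t(1) le U(1)
      by (intro add_mono contr mult_left_mono abs_Phi1_le) auto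
    also have "\<dots> = 1 / 2 * \<bar>U c t - U d t\<bar> + \<bar>d - c\<bar> * B" by (simp add: exp_minus)
    finally have *: "\<bar>U c t - U d t\<bar> \<le> 2 * B * \<bar>c - d\<bar>" by (simp add: abs_minus_commute mult_ac)
    \<comment> \<open>The weight \<open>exp (- (k * t))\<close> is at most 1 because
      \<open>k\<close> and \<open>t\<close> are positive; the bound is then carried from
      \<open>t\<close> to \<open>b\<close>.\<close>
    have "?f t \<le> 1 * (2 * B * \<bar>c - d\<bar>)"
      using * k(1) t(1) a_pos by (intro mult_mono) auto
    then have "?f t * exp (k * b) \<le> 1 * (2 * B * \<bar>c - d\<bar>) * exp (k * b)"
      by (rule mult_right_mono) simp
    then have "\<bar>U c b - U d b\<bar> \<le> 1 * (2 * B * \<bar>c - d\<bar>) * exp (k * b)"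
      using a_less_b by (intro order.trans[OF le[of b]]) auto
    then show ?thesis by (simp add: mult_ac)
  qed
  have "continuous_on {0..M} (\<lambda>c. U c b)"
    using U_lip \<open>0 \<le> B\<close>
    by (intro lipschitz_on_continuous_on[of "2 * B * exp (k * b)"] lipschitz_onI) (auto simp: dist_real_def)
  moreover have "U M b \<le> 0"
  proof -
    have "M * m \<le> M * Phi1 L N \<nu> a b (U M)"
      using \<open>0 < M\<close> Phi1_end_ge[OF U(1)[of M]] unfolding m_def by (intro mult_left_mono) auto
    then show ?thesis using U(2)[of M b] \<open>0 < M\<close> \<open>0 < m\<close> a_less_b by (simp add: M_def)
  qed
  moreover have "U 0 b = 1" using U(2)[of 0 b] \<open>0 < M\<close> a_less_b by simp
  \<comment> \<open>The end value passes from 1 at \<open>c = 0\<close> to at most 0 at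
    \<open>c = M\<close>. Where it vanishes, \<open>c\<close> is the reciprocal of
    \<open>Phi1\<close> at \<open>b\<close>.\<close>
  ultimately obtain c where c: "c \<in> {0..M}" "U c b = 0"
    using IVT2'[of "\<lambda>c. U c b" M 0 0] \<open>0 < M\<close> by auto
  then have "c * Phi1 L N \<nu> a b (U c) = 1" using U(2)[of c b] a_less_b by simp
  then have c_eq: "c = 1 / Phi1 L N \<nu> a b (U c)"
    using Phi1_end_pos[OF U(1)[OF c(1)]] by (simp add: field_simps)
  show thesis
  proof (rule that[OF U(1)[OF c(1)]])
    fix s assume "s \<in> {a..b}"
    then show "U c s = 1 - Phi1 L N \<nu> a s (U c) / Phi1 L N \<nu> a b (U c)"
      using U(2)[OF c(1)] c_eq by (metis mult.commute times_divide_eq_right mult_1_right)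
  qed
qed

section \<open>Uniqueness by comparing fluxes\<close>

text \<open>The two constants are independent of each other, so exchanging the roles of
  \<open>u\<close> and \<open>v\<close> gives the reverse inequality. At \<open>a\<close> both
  functions equal 1, since \<open>Phi1\<close> vanishes there.\<close>

lemma comparison:
  assumes u: "continuous_on {a..b} u" and v: "continuous_on {a..b} v"
    and u_eq: "\<And>s. s \<in> {a..b} \<Longrightarrow> u s = 1 - c\<^sub>u * Phi1 L N \<nu> a s u"
    and v_eq: "\<And>s. s \<in> {a..b} \<Longrightarrow> v s = 1 - c\<^sub>v * Phi1 L N \<nu> a s v"
    and end_eq: "u b = v b" and s: "s \<in> {a..b}"
  shows "u s \<le> v s"
proof (rule ccontr)
  assume "\<not> u s \<le> v s"
  moreover have "u a = v a" using u_eq[of a] v_eq[of a] a_less_b by (simp add: Phi1_eq)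
  moreover have "continuous_on {a..b} (\<lambda>s. u s - v s)" by (intro continuous_intros u v)
  ultimately obtain c d where cd: "a \<le> c" "c < d" "d \<le> b" "u c = v c" "u d = v d"
    and pos: "\<And>x. c < x \<Longrightarrow> x < d \<Longrightarrow> v x < u x"
    using positive_component[of a b "\<lambda>s. u s - v s" s] end_eq s by auto
  have sub: "{c..d} \<subseteq> {a..b}" using cd by auto
  have u_deriv: "(u has_real_derivative - c\<^sub>u * w u x) (at x within {a..b})" if "x \<in> {a..b}" for x
    by (rule has_field_derivative_transform_within[OF _ zero_less_one that, of "\<lambda>s. 1 - c\<^sub>u * Phi1 L N \<nu> a s u"])
      (use u_eq in \<open>auto intro!: derivative_eq_intros Phi1_deriv[OF u that]\<close>)
  have v_deriv: "(v has_real_derivative - c\<^sub>v * w v x) (at x within {a..b})" if "x \<in> {a..b}" for x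
    by (rule has_field_derivative_transform_within[OF _ zero_less_one that, of "\<lambda>s. 1 - c\<^sub>v * Phi1 L N \<nu> a s v"])
      (use v_eq in \<open>auto intro!: derivative_eq_intros Phi1_deriv[OF v that]\<close>)
  have diff_deriv: "((\<lambda>s. u s - v s) has_real_derivative c\<^sub>v * w v x - c\<^sub>u * w u x) (at x within {a..b})"
    if "x \<in> {a..b}" for x
    using DERIV_diff[OF u_deriv[OF that] v_deriv[OF that]] by simp
  \<comment> \<open>From \<open>u' = - c\<^sub>u * w u\<close> the flux of \<open>u\<close> is
    \<open>- c\<^sub>u * E1\<close>, and likewise for \<open>v\<close>; \<open>P\<close> is the flux
    of \<open>u\<close> minus that of \<open>v\<close>.\<close>
  define P where "P s = c\<^sub>v * E1 L N a s v - c\<^sub>u * E1 L N a s u" for s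
  \<comment> \<open>Where \<open>u\<close> and \<open>v\<close> agree, the denominators of the two
    terms coincide, so \<open>P\<close> has the sign of the derivative of \<open>u - v\<close>. This
    difference is positive inside \<open>(c, d)\<close> and zero at both ends.\<close>
  have P_eq: "c\<^sub>v * w v x - c\<^sub>u * w u x = P x / (x powr \<nu> * L (u x))" if "u x = v x" for x
    using that by (simp add: P_def w_def diff_divide_distrib)
  have den: "0 < x powr \<nu> * L (u x)" if "x \<in> {a..b}" for x using that a_pos L_pos by simp
  have "0 \<le> P c / (c powr \<nu> * L (u c))"
    unfolding P_eq[OF cd(4), symmetric]
    using cd pos by (intro has_real_derivative_nonneg_right[OF diff_deriv _ sub]) (auto simp: less_imp_le)
  then have Pc: "0 \<le> P c" using den[of c] cd by (simp add: zero_le_divide_iff)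
  have "P d / (d powr \<nu> * L (u d)) \<le> 0"
    unfolding P_eq[OF cd(5), symmetric]
    using cd pos by (intro has_real_derivative_nonpos_left[OF diff_deriv _ sub]) (auto simp: less_imp_le)
  then have Pd: "P d \<le> 0" using den[of d] cd by (simp add: divide_le_0_iff)

  \<comment> \<open>With an antiderivative of \<open>N\<close>, the term \<open>N(u) u'\<close>
    becomes the derivative of \<open>G(u)\<close>, and the product rule leaves a remainder free of
    \<open>u'\<close>.\<close>
  obtain G where G: "\<And>x. (G has_real_derivative N x) (at x)"
    using einterval_antiderivative[of "-\<infinity>" \<infinity> N] cont_N[of UNIV]
    by (auto simp: has_real_derivative_iff_has_vector_derivative continuous_on_eq_continuous_at)
  define Q where "Q s = P s + 2 * s powr (\<nu> + 1) * (G (u s) - G (v s))" for s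
  have Q_deriv: "(Q has_real_derivative 2 * (\<nu> + 1) * x powr \<nu> * (G (u x) - G (v x))) (at x within {a..b})"
    if x: "x \<in> {a..b}" for x
  proof -
    have x0: "0 < x" using x a_pos by auto
    have Gu: "((\<lambda>s. G (u s)) has_real_derivative N (u x) * (- c\<^sub>u * w u x)) (at x within {a..b})"
      by (rule DERIV_chain2[OF G u_deriv[OF x]])
    have Gv: "((\<lambda>s. G (v s)) has_real_derivative N (v x) * (- c\<^sub>v * w v x)) (at x within {a..b})"
      by (rule DERIV_chain2[OF G v_deriv[OF x]])
    have pw: "((\<lambda>s. s powr (\<nu> + 1)) has_real_derivative (\<nu> + 1) * x powr \<nu>) (at x within {a..b})"
      using has_real_derivative_powr[OF x0, of "\<nu> + 1"] by (auto intro: has_field_derivative_at_within)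
    have "x powr (\<nu> + 1) = x * x powr \<nu>" using x0 by (simp add: powr_add)
    then have wu: "x powr (\<nu> + 1) * w u x = x * E1 L N a x u / L (u x)"
      and wv: "x powr (\<nu> + 1) * w v x = x * E1 L N a x v / L (v x)"
      using x0 by (simp_all add: w_def)
    let ?D = "c\<^sub>v * (- 2 * (x * (N (v x) / L (v x))) * E1 L N a x v)
        - c\<^sub>u * (- 2 * (x * (N (u x) / L (u x))) * E1 L N a x u)
        + (2 * ((\<nu> + 1) * x powr \<nu>) * (G (u x) - G (v x))
          + 2 * x powr (\<nu> + 1) * (N (u x) * (- c\<^sub>u * w u x) - N (v x) * (- c\<^sub>v * w v x)))"
    have "(Q has_real_derivative ?D) (at x within {a..b})"
      unfolding Q_def P_def
      by (rule derivative_eq_intros E1_deriv[OF u x] E1_deriv[OF v x] Gu Gv pw refl)+ (simp add: algebra_simps)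
    \<comment> \<open>By \<open>wu\<close> and \<open>wv\<close> both bracketed differences vanish:
      the decay of \<open>E1\<close> cancels the derivatives of \<open>G(u)\<close> and
      \<open>G(v)\<close>.\<close>
    moreover have "?D = 2 * (\<nu> + 1) * x powr \<nu> * (G (u x) - G (v x))
        + 2 * (c\<^sub>u * N (u x) * (x * E1 L N a x u / L (u x) - x powr (\<nu> + 1) * w u x))
        - 2 * (c\<^sub>v * N (v x) * (x * E1 L N a x v / L (v x) - x powr (\<nu> + 1) * w v x))"
      by (simp add: algebra_simps)
    ultimately show ?thesis unfolding wu wv by simp
  qed
  have G_mono: "G y < G x" if "y < x" for x y
    using DERIV_pos_imp_increasing[OF that, of G] G N_pos by blast
  have "Q c < Q d"
  proof (rule DERIV_pos_imp_increasing_open[OF cd(2)])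
    fix x assume x: "c < x" "x < d"
    then have x': "x \<in> {a..b}" "x \<in> interior {a..b}" using cd by auto
    have "(Q has_real_derivative 2 * (\<nu> + 1) * x powr \<nu> * (G (u x) - G (v x))) (at x)"
      using Q_deriv[OF x'(1)] at_within_interior[OF x'(2)] by simp
    moreover have "0 < 2 * (\<nu> + 1) * x powr \<nu> * (G (u x) - G (v x))"
      using G_mono[OF pos[OF x]] x' a_pos \<nu>_pos by simp
    ultimately show "\<exists>y. (Q has_real_derivative y) (at x) \<and> 0 < y" by blast
  next
    have "continuous_on {a..b} Q"
      using Q_deriv by (meson DERIV_continuous continuous_on_eq_continuous_within)
    then show "continuous_on {c..d} Q" using sub by (rule continuous_on_subset)
  qed
  \<comment> \<open>At \<open>c\<close> and \<open>d\<close> the terms with \<open>G\<close> cancel,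
    so \<open>Q\<close> equals \<open>P\<close> there and \<open>P c < P d\<close> contradicts the
    signs found above.\<close>
  then show False using Pc Pd cd by (simp add: Q_def)
qed

theorem uniqueness:
  assumes u: "continuous_on {a..b} u" and v: "continuous_on {a..b} v"
    and u_eq: "\<And>s. s \<in> {a..b} \<Longrightarrow> u s = 1 - Phi1 L N \<nu> a s u / Phi1 L N \<nu> a b u"
    and v_eq: "\<And>s. s \<in> {a..b} \<Longrightarrow> v s = 1 - Phi1 L N \<nu> a s v / Phi1 L N \<nu> a b v"
    and s: "s \<in> {a..b}"
  shows "u s = v s"
proof (rule antisym)
  \<comment> \<open>Both end values are 0, because the quotient at \<open>b\<close> has equal
    nonzero numerator and denominator.\<close>
  have end_eq: "u b = v b"
    using u_eq[of b] v_eq[of b] Phi1_end_pos[OF u] Phi1_end_pos[OF v] a_less_b by simp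
  show "u s \<le> v s"
    by (rule comparison[OF u v, of "1 / Phi1 L N \<nu> a b u" "1 / Phi1 L N \<nu> a b v"])
      (use u_eq v_eq end_eq s in auto)
  show "v s \<le> u s"
    by (rule comparison[OF v u, of "1 / Phi1 L N \<nu> a b v" "1 / Phi1 L N \<nu> a b u"])
      (use u_eq v_eq end_eq s in auto)
qed

end

section \<open>Passage between function spaces and pointwise conditions\<close>

lemma Phi1_cong:
  assumes "\<And>s. s \<in> {\<alpha>..\<eta>} \<Longrightarrow> u s = v s"
  shows "Phi1 L N \<nu> \<alpha> \<eta> u = Phi1 L N \<nu> \<alpha> \<eta> v"
proof -
  have "E1 L N \<alpha> s u = E1 L N \<alpha> s v" if "s \<in> {\<alpha>..\<eta>}" for s
    unfolding E1_def using that assms by (intro arg_cong[of _ _ "\<lambda>x. exp (- 2 * x)"] integral_cong) auto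
  then show ?thesis unfolding Phi1_def using assms by (intro integral_cong) auto
qed

lemma restrict_in_C0: "continuous_on S u \<Longrightarrow> restrict u S \<in> C0 S"
  by (simp add: C0_def cong: continuous_on_cong_simp)

lemma sup_norm_const:
  assumes "S \<noteq> {}" "\<And>x. x \<in> S \<Longrightarrow> f x = c"
  shows "sup_norm S f = \<bar>c\<bar>"
  unfolding sup_norm_def using assms by (simp cong: SUP_cong)

text \<open>Constant functions are continuous and bounded, and on them both supremum norms collapse
  to absolute values.\<close>

lemma pointwise_lipschitz:
  assumes "\<forall>f \<in> C0 {0..}. \<forall>g \<in> C0 {0..}. bounded (f ` {0..}) \<longrightarrow> bounded (g ` {0..}) \<longrightarrow>
    sup_norm {0..} (\<lambda>x. F (f x) - F (g x)) \<le> K * sup_norm {0..} (\<lambda>x. f x - g x)"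
  shows "\<bar>F x - F y\<bar> \<le> K * \<bar>x - y\<bar>"
proof -
  define f where "f z = restrict (\<lambda>_::real. z) {0::real..}" for z :: real
  have "f z \<in> C0 {0..}" "bounded (f z ` {0..})" for z
    unfolding f_def by (auto intro!: restrict_in_C0 simp: image_constant_conv)
  then have "sup_norm {0..} (\<lambda>t. F (f x t) - F (f y t)) \<le> K * sup_norm {0..} (\<lambda>t. f x t - f y t)"
    using assms by blast
  moreover have "sup_norm {0..} (\<lambda>t. F (f x t) - F (f y t)) = \<bar>F x - F y\<bar>"
    by (rule sup_norm_const) (auto simp: f_def)
  moreover have "sup_norm {0..} (\<lambda>t. f x t - f y t) = \<bar>x - y\<bar>"
    by (rule sup_norm_const) (auto simp: f_def)
  ultimately show ?thesis by simp
qed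

theorem theorem3p5:
  fixes \<nu> \<alpha>\<^sub>0 \<beta>\<^sub>0 Lm LM Nm NM Lt Nt :: real
    and L\<^sub>1 N\<^sub>1 :: "real \<Rightarrow> real"
  assumes "0 < \<nu>" and "\<nu> < 1"
    and "0 < \<alpha>\<^sub>0" and "\<alpha>\<^sub>0 < \<beta>\<^sub>0"
    and "0 < Lm" and "0 < LM" and "0 < Nm" and "0 < NM"
    and L_bounds: "\<forall>u \<in> C0 {\<alpha>\<^sub>0..\<beta>\<^sub>0}. \<forall>\<eta> \<in> {\<alpha>\<^sub>0..\<beta>\<^sub>0}. Lm \<le> L\<^sub>1 (u \<eta>) \<and> L\<^sub>1 (u \<eta>) \<le> LM"
    and N_bounds: "\<forall>u \<in> C0 {\<alpha>\<^sub>0..\<beta>\<^sub>0}. \<forall>\<eta> \<in> {\<alpha>\<^sub>0..\<beta>\<^sub>0}. Nm \<le> N\<^sub>1 (u \<eta>) \<and> N\<^sub>1 (u \<eta>) \<le> NM"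
    and L_lipschitz: "\<forall>f \<in> C0 {0..}. \<forall>g \<in> C0 {0..}. bounded (f ` {0..}) \<longrightarrow> bounded (g ` {0..}) \<longrightarrow>
           sup_norm {0..} (\<lambda>x. L\<^sub>1 (f x) - L\<^sub>1 (g x)) \<le> Lt * sup_norm {0..} (\<lambda>x. f x - g x)"
    and N_lipschitz: "\<forall>f \<in> C0 {0..}. \<forall>g \<in> C0 {0..}. bounded (f ` {0..}) \<longrightarrow> bounded (g ` {0..}) \<longrightarrow>
           sup_norm {0..} (\<lambda>x. N\<^sub>1 (f x) - N\<^sub>1 (g x)) \<le> Nt * sup_norm {0..} (\<lambda>x. f x - g x)"
    and contraction: "eps Lm LM Nm NM Lt Nt \<nu> \<alpha>\<^sub>0 \<beta>\<^sub>0 < 1"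
  shows "\<exists>!u. u \<in> C0 {\<alpha>\<^sub>0..\<beta>\<^sub>0} \<and>
           (\<forall>\<eta> \<in> {\<alpha>\<^sub>0..\<beta>\<^sub>0}. u \<eta> = 1 - Phi1 L\<^sub>1 N\<^sub>1 \<nu> \<alpha>\<^sub>0 \<eta> u / Phi1 L\<^sub>1 N\<^sub>1 \<nu> \<alpha>\<^sub>0 \<beta>\<^sub>0 u)"
proof -
  \<comment> \<open>Every real \<open>x\<close> is the value at \<open>\<alpha>\<^sub>0\<close> of a
    constant element of \<open>C0\<close>, so the bounds on compositions hold on all of the real
    line.\<close>
  have const: "restrict (\<lambda>_. x) {\<alpha>\<^sub>0..\<beta>\<^sub>0} \<in> C0 {\<alpha>\<^sub>0..\<beta>\<^sub>0}" for x
    by (intro restrict_in_C0 continuous_intros)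
  have L: "Lm \<le> L\<^sub>1 x" "L\<^sub>1 x \<le> LM" for x
    using L_bounds[rule_format, OF const[of x], of \<alpha>\<^sub>0] \<open>\<alpha>\<^sub>0 < \<beta>\<^sub>0\<close> by auto
  have N: "Nm \<le> N\<^sub>1 x" "N\<^sub>1 x \<le> NM" for x
    using N_bounds[rule_format, OF const[of x], of \<alpha>\<^sub>0] \<open>\<alpha>\<^sub>0 < \<beta>\<^sub>0\<close> by auto
  interpret similarity_bvp L\<^sub>1 N\<^sub>1 \<nu> \<alpha>\<^sub>0 \<beta>\<^sub>0 Lm LM NM Lt Nt
    using assms(1-8) L N less_le_trans[OF \<open>0 < Nm\<close> N(1)]
      pointwise_lipschitz[OF L_lipschitz] pointwise_lipschitz[OF N_lipschitz]
    by unfold_locales auto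
  obtain u where u: "continuous_on {\<alpha>\<^sub>0..\<beta>\<^sub>0} u"
    "\<And>s. s \<in> {\<alpha>\<^sub>0..\<beta>\<^sub>0} \<Longrightarrow> u s = 1 - Phi1 L\<^sub>1 N\<^sub>1 \<nu> \<alpha>\<^sub>0 s u / Phi1 L\<^sub>1 N\<^sub>1 \<nu> \<alpha>\<^sub>0 \<beta>\<^sub>0 u"
    using existence by blast
  \<comment> \<open>Restriction supplies the value \<open>undefined\<close> outside the interval
    that \<open>C0\<close> requires; \<open>Phi1\<close> does not see the change.\<close>
  let ?u = "restrict u {\<alpha>\<^sub>0..\<beta>\<^sub>0}"
  have Phi: "Phi1 L\<^sub>1 N\<^sub>1 \<nu> \<alpha>\<^sub>0 s ?u = Phi1 L\<^sub>1 N\<^sub>1 \<nu> \<alpha>\<^sub>0 s u" if "s \<in> {\<alpha>\<^sub>0..\<beta>\<^sub>0}" for s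
    using that by (intro Phi1_cong) auto
  show ?thesis
  proof (rule ex1I[of _ ?u])
    show "?u \<in> C0 {\<alpha>\<^sub>0..\<beta>\<^sub>0} \<and>
        (\<forall>\<eta> \<in> {\<alpha>\<^sub>0..\<beta>\<^sub>0}. ?u \<eta> = 1 - Phi1 L\<^sub>1 N\<^sub>1 \<nu> \<alpha>\<^sub>0 \<eta> ?u / Phi1 L\<^sub>1 N\<^sub>1 \<nu> \<alpha>\<^sub>0 \<beta>\<^sub>0 ?u)"
      using u Phi \<open>\<alpha>\<^sub>0 < \<beta>\<^sub>0\<close> by (auto intro: restrict_in_C0)
  next
    fix v assume v: "v \<in> C0 {\<alpha>\<^sub>0..\<beta>\<^sub>0} \<and>
        (\<forall>\<eta> \<in> {\<alpha>\<^sub>0..\<beta>\<^sub>0}. v \<eta> = 1 - Phi1 L\<^sub>1 N\<^sub>1 \<nu> \<alpha>\<^sub>0 \<eta> v / Phi1 L\<^sub>1 N\<^sub>1 \<nu> \<alpha>\<^sub>0 \<beta>\<^sub>0 v)"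
    then have "v s = u s" if "s \<in> {\<alpha>\<^sub>0..\<beta>\<^sub>0}" for s
      using uniqueness[OF _ u(1) _ u(2) that, of v] by (auto simp: C0_def)
    \<comment> \<open>Agreement on the interval yields equality as functions because both are
      \<open>undefined\<close> elsewhere.\<close>
    then show "v = ?u" using v by (intro extensionalityI[of _ "{\<alpha>\<^sub>0..\<beta>\<^sub>0}"]) (auto simp: C0_def)
  qed
qed

end
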